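(* Let $M\ge 1$ and $N\ge 0$ be integers. For every $\epsilon=(\epsilon_0,\dots,\epsilon_{N-1})\in\{0,1\}^N$ and every $u\in\Omega_N$ (every $u\in\Omega$ lies in $\Omega_N$ for exactly one $N$), the two semi-standard tableaux $$\varnothing\leftarrow f(u)\qquad\text{and}\qquad \varnothing\leftarrow f(T_\epsilon(u))$$ coincide, where $T_\epsilon$ is the time evolution of the hungry $\epsilon$-BBS. That is, the P-symbol is a conserved quantity of the hungry $\epsilon$-BBS.
   Context: **Tableaux.** Letters are $[M]=\{1,\dots,M\}$. A semi-standard tableau (SST) is a filling of a Young diagram with letters, non-decreasing along rows from left to right and strictly increasing down columns. Schensted insertion $T\leftarrow x$ of a letter $x$ into an SST $T$: starting with row $k=1$, find the leftmost letter in row $k$ that is greater than $x$; if there is none, append $x$ to the right end of row $k$ and stop; otherwise, if it is $y$, replace it by $x$, set $x:=y$, $k:=k+1$, and repeat. For a word $w=w_1\cdots w_l$, $T\leftarrow w := (\cdots((T\leftarrow w_1)\leftarrow w_2)\cdots)\leftarrow w_l$; $\varnothing$ is the empty tableau. $\varnothing\leftarrow w$ is the P-symbol of $w$. **States.** $\Omega$ is the set of sequences $u=(u_i)_{i\ge0}$ with $u_i\in[M]\cup\{e\}$ and $u_i=e$ for all but finitely many $i$. The letter $e$ (empty box) is regarded as greater than every element of $[M]$; the letter $j\in[M]$ is a ball of color $j$. $f(u)$ is the finite word obtained from $u$ by deleting all $e$'s. $\operatorname{des}(u)$ is the number of $i$ with $u_i>u_{i+1}$. $\Omega_N$ is the set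 of $u\in\Omega$ such that $\operatorname{des}(u)=N-1$ if $u_0\ne e$ and $\operatorname{des}(u)=N$ if $u_0=e$. **Coordinates.** For nonnegative integers $Q=(Q_i^{(j)})_{0\le i\le N-1,\,0\le j\le M-1}$ and $E=(E_i)_{-1\le i\le N-2}$ ($N\ge1$), $\Phi_N(Q,E)\in\Omega$ is the sequence consisting of: $E_{-1}$ letters $e$; then block 1; then $E_0$ letters $e$; then block 2; …; then $E_{N-2}$ letters $e$; then block $N$; then infinitely many $e$'s; where block $i+1$ is the non-decreasing word containing exactly $Q_i^{(j)}$ copies of the letter $j+1$ for $0\le j\le M-1$. For $u\in\Omega_N$, $N\ge1$, cutting $u$ at its descents gives maximal non-decreasing runs; discarding the initial run of $e$'s if $u_0=e$ (its length is $E_{-1}$; otherwise $E_{-1}=0$), there are $N$ runs, each consisting of a nonempty non-decreasing word of balls (block $i+1$) followed by $E_i$ letters $e$ (infinitely many for the last run). This determines $(Q,E)$, denoted $\Phi_N^{-1}(u)$. **Time evolution.** Given $u\in\Omega_N$, $N\ge1$, and $\epsilon\in\{0,1\}^N$, let $(Q_i^{(j)})_{0\le j\le M-1}$ and $E_i^{(0)}:=E_i$ be the coordinates of $u$. For $t=0,1,\dots,M-1$ define $Q_i^{(t+M)}$, $D_i^{(t+1)}$ ($0\le i\le N-1$) and $E_i^{(t+1)}$ ($-1\le i\le N-2$) as follows, with $E_{N-1}^{(t)}:=+\infty$, and $\mathcal E_i:=+\infty$ if $\epsilon_i=0$, $\mathcal E_i:=0$ if $\epsilon_i=1$. For $i=0$: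 if $\epsilon_0=0$, then $D_0^{(t+1)}=Q_0^{(t)}$ and $Q_0^{(t+M)}=\min(D_0^{(t+1)},E_0^{(t)})$; if $\epsilon_0=1$, then $D_0^{(t+1)}=Q_0^{(t+M)}=\min(Q_0^{(t)},E_0^{(t)})$. For $1\le i\le N-1$: - $(\epsilon_{i-1},\epsilon_i)=(0,0)$: $D_i^{(t+1)}=Q_i^{(t)}+D_{i-1}^{(t+1)}-Q_{i-1}^{(t+M)}$, $\;Q_i^{(t+M)}=\min(D_i^{(t+1)},E_i^{(t)})$; - $(1,1)$: $D_i^{(t+1)}=\min(Q_i^{(t)},E_i^{(t)})$, $\;Q_i^{(t+M)}=D_i^{(t+1)}+Q_{i-1}^{(t)}-D_{i-1}^{(t+1)}$; - $(0,1)$: $D_i^{(t+1)}=\min(Q_i^{(t)},E_i^{(t)})$, $\;Q_i^{(t+M)}=D_i^{(t+1)}+D_{i-1}^{(t+1)}-Q_{i-1}^{(t+M)}$; - $(1,0)$: $D_i^{(t+1)}=Q_i^{(t)}+Q_{i-1}^{(t)}-D_{i-1}^{(t+1)}$, $\;Q_i^{(t+M)}=\min(D_i^{(t+1)},E_i^{(t)})$. For $0\le i\le N-2$: $$E_i^{(t+1)}=\min(Q_{i+1}^{(t)},\mathcal E_{i+1}+E_{i+1}^{(t)})-\min(Q_i^{(t+M)},\mathcal E_i+E_{i-1}^{(t+1)})+E_i^{(t)},$$ where for $i=0$ the second minimum is read as $Q_0^{(t+M)}$ (the term with $E_{-1}$ is $+\infty$ there). Finally $E_{-1}^{(t+1)}=E_{-1}^{(t)}+\min(Q_0^{(t)},\mathcal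 E_0+E_0^{(t)})$. All these quantities are nonnegative integers. Then $$T_\epsilon(u):=\Phi_N\big((Q_i^{(M+j)})_{0\le i\le N-1,\,0\le j\le M-1},\ (E_i^{(M)})_{-1\le i\le N-2}\big).$$ For $N=0$ ($u$ has no balls), $T_\epsilon(u):=u$. *)

theory Defs
  imports Main "HOL-Library.Extended_Nat"
begin

section \<open>Schensted insertion\<close>

text \<open>A tableau is the list of its rows, from top to bottom. Inserting a letter into a row returns
  the new row and the letter that was bumped, if any.\<close>

fun row_insert :: "'a::linorder list \<Rightarrow> 'a \<Rightarrow> 'a list \<times> 'a option" where
  "row_insert [] x = ([x], None)"
| "row_insert (y # ys) x =
     (if x < y then (x # ys, Some y)
      else (let (zs, b) = row_insert ys x in (y # zs, b)))"

fun schensted_insert :: "'a::linorder list list \<Rightarrow> 'a \<Rightarrow> 'a list list" where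
  "schensted_insert [] x = [[x]]"
| "schensted_insert (r # rs) x =
     (case row_insert r x of
        (r', None) \<Rightarrow> r' # rs
      | (r', Some y) \<Rightarrow> r' # schensted_insert rs y)"

definition P_symbol :: "'a::linorder list \<Rightarrow> 'a list list" where
  "P_symbol w = foldl schensted_insert [] w"


section \<open>States\<close>

text \<open>A ball of color \<open>j\<close> is the letter \<open>enat j\<close> and the empty box is \<open>\<infinity>\<close>, so that the order of
  \<^typ>\<open>enat\<close> makes the empty box greater than every color.\<close>

type_synonym state = "nat \<Rightarrow> enat"

abbreviation empty_box :: enat where
  "empty_box \<equiv> \<infinity>"

definition Omega :: "nat \<Rightarrow> state set" where
  "Omega M = {u. (\<forall>i. u i \<in> enat ` {1..M} \<union> {empty_box}) \<and> finite {i. u i \<noteq> empty_box}}"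

definition ball_word :: "state \<Rightarrow> enat list" where
  "ball_word u = map u (sorted_list_of_set {i. u i \<noteq> empty_box})"

definition des :: "state \<Rightarrow> nat" where
  "des u = card {i. u i > u (Suc i)}"

text \<open>The condition \<open>des u = N - 1\<close> is written without subtraction, so that it fails for \<open>N = 0\<close>.\<close>

definition Omega_N :: "nat \<Rightarrow> nat \<Rightarrow> state set" where
  "Omega_N M N =
     {u \<in> Omega M. (u 0 \<noteq> empty_box \<longrightarrow> des u + 1 = N) \<and> (u 0 = empty_box \<longrightarrow> des u = N)}"

lemma ex1_Omega_N:
  assumes "u \<in> Omega M"
  shows "\<exists>!N. u \<in> Omega_N M N"
  using assms by (cases "u 0 = empty_box") (auto simp: Omega_N_def)


section \<open>Coordinates\<close>

text \<open>The gaps \<open>(E\<^sub>i)\<close> with \<open>-1 \<le> i \<le> N - 2\<close> are split into the number \<open>L = E\<^bsub>-1\<^esub>\<close> and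
  a function \<open>E\<close> on naturals whose values at \<open>i \<ge> N - 1\<close> are never used.\<close>

definition block :: "nat \<Rightarrow> (nat \<Rightarrow> nat) \<Rightarrow> enat list" where
  "block M q = concat (map (\<lambda>j. replicate (q j) (enat (j + 1))) [0..<M])"

definition Phi :: "nat \<Rightarrow> nat \<Rightarrow> (nat \<Rightarrow> nat \<Rightarrow> nat) \<Rightarrow> nat \<Rightarrow> (nat \<Rightarrow> nat) \<Rightarrow> state" where
  "Phi M N Q L E =
     (let w = replicate L empty_box @
              concat (map (\<lambda>i. block M (Q i) @
                               (if i + 1 < N then replicate (E i) empty_box else [])) [0..<N])
      in (\<lambda>p. if p < length w then w ! p else empty_box))"

text \<open>Cutting at the descents, position \<open>p\<close> lies in the run whose index (from 0) is the number of
  descents before \<open>p\<close>. An initial run of empty boxes carries no block and shifts the indices by one.\<close>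

definition run :: "state \<Rightarrow> nat \<Rightarrow> nat set" where
  "run u k = {p. card {i. i < p \<and> u i > u (Suc i)} = k}"

definition block_run :: "state \<Rightarrow> nat \<Rightarrow> nat set" where
  "block_run u i = run u (if u 0 = empty_box then i + 1 else i)"

definition coord_Q :: "state \<Rightarrow> nat \<Rightarrow> nat \<Rightarrow> nat" where
  "coord_Q u i j = card {p \<in> block_run u i. u p = enat (j + 1)}"

definition coord_E :: "state \<Rightarrow> nat \<Rightarrow> nat" where
  "coord_E u i = card {p \<in> block_run u i. u p = empty_box}"

definition coord_L :: "state \<Rightarrow> nat" where
  "coord_L u = (if u 0 = empty_box then card (run u 0) else 0)"


section \<open>Time evolution\<close>

definition min_ext :: "nat \<Rightarrow> enat \<Rightarrow> nat" where
  "min_ext x a = the_enat (min (enat x) a)"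

definition ext_E :: "nat \<Rightarrow> (nat \<Rightarrow> nat) \<Rightarrow> nat \<Rightarrow> enat" where
  "ext_E N E i = (if i + 1 < N then enat (E i) else \<infinity>)"

definition cal_E :: "nat \<Rightarrow> enat" where
  "cal_E e = (if e = 0 then \<infinity> else 0)"

text \<open>One step \<open>t \<mapsto> t + 1\<close>: here \<open>Q i\<close> and \<open>E i\<close> stand for \<open>Q\<^sub>i\<^bsup>(t)\<^esup>\<close> and \<open>E\<^sub>i\<^bsup>(t)\<^esup>\<close>, and the
  functions return \<open>D\<^sub>i\<^bsup>(t+1)\<^esup>\<close>, \<open>Q\<^sub>i\<^bsup>(t+M)\<^esup>\<close> and \<open>E\<^sub>i\<^bsup>(t+1)\<^esup>\<close>. All quantities are nonnegative
  integers; in each difference of naturals everything positive is added up before subtracting, so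
  truncation could only matter if the quantity itself were negative.\<close>

fun step_D :: "nat \<Rightarrow> (nat \<Rightarrow> nat) \<Rightarrow> (nat \<Rightarrow> nat) \<Rightarrow> (nat \<Rightarrow> nat) \<Rightarrow> nat \<Rightarrow> nat"
  and step_Q :: "nat \<Rightarrow> (nat \<Rightarrow> nat) \<Rightarrow> (nat \<Rightarrow> nat) \<Rightarrow> (nat \<Rightarrow> nat) \<Rightarrow> nat \<Rightarrow> nat" where
  "step_D N eps Q E 0 =
     (if eps 0 = 0 then Q 0 else min_ext (Q 0) (ext_E N E 0))"
| "step_D N eps Q E (Suc i) =
     (if eps (Suc i) = 0 then
        (if eps i = 0 then Q (Suc i) + step_D N eps Q E i - step_Q N eps Q E i
         else Q (Suc i) + Q i - step_D N eps Q E i)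
      else min_ext (Q (Suc i)) (ext_E N E (Suc i)))"
| "step_Q N eps Q E 0 =
     (if eps 0 = 0 then min_ext (step_D N eps Q E 0) (ext_E N E 0)
      else min_ext (Q 0) (ext_E N E 0))"
| "step_Q N eps Q E (Suc i) =
     (if eps (Suc i) = 0 then min_ext (step_D N eps Q E (Suc i)) (ext_E N E (Suc i))
      else
        (if eps i = 0 then step_D N eps Q E (Suc i) + step_D N eps Q E i - step_Q N eps Q E i
         else step_D N eps Q E (Suc i) + Q i - step_D N eps Q E i))"

primrec step_E :: "nat \<Rightarrow> (nat \<Rightarrow> nat) \<Rightarrow> (nat \<Rightarrow> nat) \<Rightarrow> (nat \<Rightarrow> nat) \<Rightarrow> nat \<Rightarrow> nat" where
  "step_E N eps Q E 0 =
     min_ext (Q 1) (cal_E (eps 1) + ext_E N E 1) + E 0 - step_Q N eps Q E 0"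
| "step_E N eps Q E (Suc i) =
     min_ext (Q (i + 2)) (cal_E (eps (i + 2)) + ext_E N E (i + 2)) + E (Suc i)
     - min_ext (step_Q N eps Q E (Suc i)) (cal_E (eps (Suc i)) + enat (step_E N eps Q E i))"

definition step_L :: "nat \<Rightarrow> (nat \<Rightarrow> nat) \<Rightarrow> (nat \<Rightarrow> nat) \<Rightarrow> (nat \<Rightarrow> nat) \<Rightarrow> nat \<Rightarrow> nat" where
  "step_L N eps Q E L = L + min_ext (Q 0) (cal_E (eps 0) + ext_E N E 0)"

text \<open>\<open>evol_E \<dots> t\<close> and \<open>evol_L \<dots> t\<close> are \<open>E\<^bsup>(t)\<^esup>\<close> and \<open>E\<^bsub>-1\<^esub>\<^bsup>(t)\<^esup>\<close>, and \<open>evol_Q \<dots> i t\<close> is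
  \<open>Q\<^sub>i\<^bsup>(t+M)\<^esup>\<close>. For \<open>t < M\<close> the step from \<open>t\<close> reads only the initial coordinates \<open>Q\<^sub>i\<^bsup>(t)\<^esup>\<close>.\<close>

primrec evol_E :: "nat \<Rightarrow> (nat \<Rightarrow> nat) \<Rightarrow> (nat \<Rightarrow> nat \<Rightarrow> nat) \<Rightarrow> (nat \<Rightarrow> nat) \<Rightarrow> nat \<Rightarrow> nat \<Rightarrow> nat" where
  "evol_E N eps Q E 0 = E"
| "evol_E N eps Q E (Suc t) = step_E N eps (\<lambda>i. Q i t) (evol_E N eps Q E t)"

definition evol_Q :: "nat \<Rightarrow> (nat \<Rightarrow> nat) \<Rightarrow> (nat \<Rightarrow> nat \<Rightarrow> nat) \<Rightarrow> (nat \<Rightarrow> nat) \<Rightarrow> nat \<Rightarrow> nat \<Rightarrow> nat" where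
  "evol_Q N eps Q E i t = step_Q N eps (\<lambda>i. Q i t) (evol_E N eps Q E t) i"

primrec evol_L :: "nat \<Rightarrow> (nat \<Rightarrow> nat) \<Rightarrow> (nat \<Rightarrow> nat \<Rightarrow> nat) \<Rightarrow> (nat \<Rightarrow> nat) \<Rightarrow> nat \<Rightarrow> nat \<Rightarrow> nat" where
  "evol_L N eps Q E L 0 = L"
| "evol_L N eps Q E L (Suc t) =
     step_L N eps (\<lambda>i. Q i t) (evol_E N eps Q E t) (evol_L N eps Q E L t)"

definition time_evolution :: "nat \<Rightarrow> nat \<Rightarrow> (nat \<Rightarrow> nat) \<Rightarrow> state \<Rightarrow> state" where
  "time_evolution M N eps u =
     (if N = 0 then u
      else Phi M N (evol_Q N eps (coord_Q u) (coord_E u))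
                   (evol_L N eps (coord_Q u) (coord_E u) (coord_L u) M)
                   (evol_E N eps (coord_Q u) (coord_E u) M))"

end

theory Submission
  imports Defs "HOL-Library.Multiset"
begin

text \<open>The color-by-color recursion can be reorganised gap by gap. At the gap \<open>i\<close> the row of balls
  in block \<open>i\<close> that may move and the row of block \<open>i + 1\<close> are exchanged through a queue with
  \<open>E\<^sub>i\<close> initial vacancies: for each color, as many balls stay behind as there are vacancies, and every
  ball of the next block leaves a vacancy for the larger colors. Such an exchange is the Schensted
  insertion of the second row, preceded by \<open>E\<^sub>i\<close> letters smaller than all colors, into the first;
  hence the words before and after it are Knuth equivalent and have the same P-symbol. The values of
  \<open>eps\<close> only determine in which order the gaps are processed.\<close>

section \<open>Knuth equivalence and the P-symbol\<close>

inductive knuth_move :: "'a::linorder list \<Rightarrow> 'a list \<Rightarrow> bool" where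
  knuth_move_1: "x < y \<Longrightarrow> y \<le> z \<Longrightarrow> knuth_move [y, z, x] [y, x, z]"
| knuth_move_2: "x \<le> y \<Longrightarrow> y < z \<Longrightarrow> knuth_move [x, z, y] [z, x, y]"

inductive knuth :: "'a::linorder list \<Rightarrow> 'a list \<Rightarrow> bool"  (infix "\<sim>" 50) where
  knuth_refl: "w \<sim> w"
| knuth_sym: "w \<sim> w' \<Longrightarrow> w' \<sim> w"
| knuth_trans: "w \<sim> w' \<Longrightarrow> w' \<sim> w'' \<Longrightarrow> w \<sim> w''"
| knuth_append: "w \<sim> w' \<Longrightarrow> u @ w @ v \<sim> u @ w' @ v"
| knuth_move: "knuth_move w w' \<Longrightarrow> w \<sim> w'"

declare knuth_refl [simp]
declare knuth_trans [trans]

lemma knuth_append_left: "w \<sim> w' \<Longrightarrow> u @ w \<sim> u @ w'"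
  using knuth_append[of w w' u "[]"] by simp

lemma knuth_append_right: "w \<sim> w' \<Longrightarrow> w @ v \<sim> w' @ v"
  using knuth_append[of w w' "[]" v] by simp

section \<open>Inserting words into a single row\<close>

fun row_insert_word :: "'a::linorder list \<Rightarrow> 'a list \<Rightarrow> 'a list \<times> 'a list" where
  "row_insert_word r [] = (r, [])"
| "row_insert_word r (x # w) =
     (case row_insert r x of (r', b) \<Rightarrow>
        (case row_insert_word r' w of (r'', out) \<Rightarrow>
           (r'', (case b of None \<Rightarrow> out | Some y \<Rightarrow> y # out))))"

text \<open>The rows below the first see only the letters bumped out of it, in the order in which
  they leave. This allows Knuth moves to be followed down a tableau row by row.\<close>

lemma foldl_schensted_insert_Cons:
  "foldl schensted_insert (r # rs) w =
     (case row_insert_word r w of (r', out) \<Rightarrow> r' # foldl schensted_insert rs out)"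
  by (induction w arbitrary: r rs) (auto split: prod.splits option.splits)

lemma set_row_insert:
  "row_insert r x = (r', b) \<Longrightarrow> set r' \<subseteq> insert x (set r) \<and> (\<forall>y. b = Some y \<longrightarrow> x < y \<and> y \<in> set r)"
  by (induction r arbitrary: r') (auto split: if_splits prod.splits)

lemma sorted_row_insert: "sorted r \<Longrightarrow> row_insert r x = (r', b) \<Longrightarrow> sorted r'"
proof (induction r arbitrary: r')
  case (Cons h t)
  show ?case
  proof (cases "x < h")
    case False
    obtain t' where t': "row_insert t x = (t', b)" "r' = h # t'"
      using Cons.prems False by (auto split: prod.splits)
    with Cons False set_row_insert[OF t'(1)] show ?thesis by auto
  next
    case True
    have "\<forall>s\<in>set t. x \<le> s"
      using Cons.prems(1) less_imp_le[OF True] order_trans[of x h] by simp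
    then show ?thesis using Cons.prems True by auto
  qed
qed simp

text \<open>Once \<open>y\<close> sits in the row, it and all letters to its left are at most
  \<open>z\<close>, so \<open>z\<close> acts strictly to the right of \<open>y\<close>.\<close>

lemma row_insert_le:
  assumes "sorted r" "y \<le> z" "row_insert r y = (r', b)" "row_insert r' z = (r'', c)"
  shows "(b = None \<longrightarrow> c = None) \<and> (\<forall>p q. b = Some p \<and> c = Some q \<longrightarrow> p \<le> q)"
  using assms
proof (induction r arbitrary: r' r'')
  case (Cons h t)
  show ?case
  proof (cases "y < h")
    case True
    obtain s where "row_insert t z = (s, c)"
      using Cons.prems True leD[OF \<open>y \<le> z\<close>] by (auto split: prod.splits)
    with set_row_insert[OF this] Cons.prems True show ?thesis by auto
  next
    case False
    obtain s' where s': "row_insert t y = (s', b)" "r' = h # s'"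
      using Cons.prems False by (auto split: prod.splits)
    obtain s'' where "row_insert s' z = (s'', c)"
      using Cons.prems False leD[OF order_trans[of h y z]] s' by (auto split: prod.splits)
    with Cons s' show ?thesis by simp
  qed
qed (use leD[OF \<open>y \<le> z\<close>] in auto)

text \<open>The letter \<open>z\<close> has taken the place of \<open>q\<close> and exceeds
  \<open>y\<close>; hence \<open>y\<close> bumps a letter at or to the left of \<open>z\<close>, and
  that letter is at most \<open>z < q\<close>.\<close>

lemma row_insert_less:
  assumes "sorted r" "y < z" "row_insert r z = (r', Some q)" "row_insert r' y = (r'', c)"
  shows "\<exists>p. c = Some p \<and> p < q"
  using assms
proof (induction r arbitrary: r' r'')
  case (Cons h t)
  show ?case
  proof (cases "z < h")
    case False
    obtain s' where s': "row_insert t z = (s', Some q)" "r' = h # s'"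
      using Cons.prems False by (auto split: prod.splits)
    show ?thesis
    proof (cases "y < h")
      case True
      with set_row_insert[OF s'(1)] s' Cons.prems False show ?thesis by auto
    next
      case False
      obtain s'' where "row_insert s' y = (s'', c)"
        using Cons.prems False s' by (auto split: prod.splits)
      with Cons s' show ?thesis by simp
    qed
  qed (use Cons.prems in auto)
qed auto

lemma row_insert_word_Cons_le:
  "\<forall>x\<in>set w. h \<le> x \<Longrightarrow>
     row_insert_word (h # t) w = (case row_insert_word t w of (r, out) \<Rightarrow> (h # r, out))"
  by (induction w arbitrary: t) (auto dest: leD split: prod.splits)

lemma row_insert_word_knuth_move_1:
  assumes "sorted r" "x < y" "y \<le> z"
    and "row_insert_word r [y, z, x] = (r1, out1)" "row_insert_word r [y, x, z] = (r2, out2)"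
  shows "r1 = r2 \<and> (out1 = out2 \<or> knuth_move out1 out2)"
  using assms
proof (induction r arbitrary: r1 r2 out1 out2)
  case Nil
  then have "x < z" "\<not> z < x" "\<not> z < y" by auto
  then show ?case using Nil by auto
next
  case (Cons h t)
  let ?word = "case_option [] (\<lambda>p. [p])"
  have ord: "x < z" "\<not> z < x" "\<not> z < y" using Cons.prems by auto
  have ht: "sorted t" "\<forall>s\<in>set t. h \<le> s" using Cons.prems by auto
  consider "h \<le> x" | "x < h" "h \<le> y" | "y < h" by force
  then show ?case
  proof cases
    case 1
    obtain s1 o1 where s1: "row_insert_word t [y, z, x] = (s1, o1)" by fastforce
    obtain s2 o2 where s2: "row_insert_word t [y, x, z] = (s2, o2)" by fastforce
    have "h \<le> y" "h \<le> z" using 1 ord Cons.prems by auto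
    then have "r1 = h # s1" "out1 = o1" "r2 = h # s2" "out2 = o2"
      using Cons.prems(4,5) s1 s2 1 row_insert_word_Cons_le[of "[y, z, x]" h t]
        row_insert_word_Cons_le[of "[y, x, z]" h t] by simp_all
    then show ?thesis
      using Cons.IH[OF ht(1) Cons.prems(2,3) s1 s2] by simp
  next
    case 2
    then have h: "\<not> y < h" "\<not> z < h" using ord by auto
    obtain s1 b where s1: "row_insert t y = (s1, b)" by fastforce
    obtain s2 c where s2: "row_insert s1 z = (s2, c)" by fastforce
    have "row_insert_word (h # t) [y, z, x] = (x # s2, ?word b @ ?word c @ [h])"
      "row_insert_word (h # t) [y, x, z] = (x # s2, ?word b @ [h] @ ?word c)"
      using 2(1) h ord s1 s2 by (simp_all split: option.split)
    with Cons.prems(4,5) have "r1 = x # s2" "r2 = x # s2"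
      "out1 = ?word b @ ?word c @ [h]" "out2 = ?word b @ [h] @ ?word c"
      by simp_all
    \<comment> \<open>Any letter bumped by \<open>y\<close> exceeds \<open>h\<close>, and
      \<open>row_insert_le\<close> orders the letters bumped by \<open>y\<close> and
      \<open>z\<close>. The outputs differ by a move of the first kind with \<open>h\<close> as
      smallest letter, or are equal.\<close>
    with row_insert_le[OF ht(1) \<open>y \<le> z\<close> s1 s2] set_row_insert[OF s1] 2 show ?thesis
      by (cases b; cases c) (auto intro!: knuth_move_1)
  next
    case 3
    obtain s c where s: "row_insert t z = (s, c)" by fastforce
    have "row_insert_word (h # t) [y, z, x] = (x # s, [h] @ ?word c @ [y])"
      "row_insert_word (h # t) [y, x, z] = (x # s, [h, y] @ ?word c)"
      using 3 ord Cons.prems(2) s by (simp_all split: option.split)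
    with Cons.prems(4,5) have "r1 = x # s" "r2 = x # s"
      "out1 = [h] @ ?word c @ [y]" "out2 = [h, y] @ ?word c"
      by simp_all
    with set_row_insert[OF s] 3 ht(2) show ?thesis
      by (cases c) (auto intro!: knuth_move_1)
  qed
qed

lemma row_insert_word_knuth_move_2:
  assumes "sorted r" "x \<le> y" "y < z"
    and "row_insert_word r [x, z, y] = (r1, out1)" "row_insert_word r [z, x, y] = (r2, out2)"
  shows "r1 = r2 \<and> (out1 = out2 \<or> knuth_move out1 out2 \<or> knuth_move out2 out1)"
  using assms
proof (induction r arbitrary: r1 r2 out1 out2)
  case Nil
  then have "x < z" "\<not> z < x" "\<not> y < x" "\<not> z < y" by auto
  then show ?case using Nil by auto
next
  case (Cons h t)
  let ?word = "case_option [] (\<lambda>p. [p])"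
  have ord: "x < z" "\<not> z < x" "\<not> y < x" "\<not> z < y" using Cons.prems by auto
  have ht: "sorted t" "\<forall>s\<in>set t. h \<le> s" using Cons.prems by auto
  consider "h \<le> x" | "x < h" "h \<le> z" | "z < h" by force
  then show ?case
  proof cases
    case 1
    obtain s1 o1 where s1: "row_insert_word t [x, z, y] = (s1, o1)" by fastforce
    obtain s2 o2 where s2: "row_insert_word t [z, x, y] = (s2, o2)" by fastforce
    have "h \<le> y" "h \<le> z" using 1 ord by auto
    then have "r1 = h # s1" "out1 = o1" "r2 = h # s2" "out2 = o2"
      using Cons.prems(4,5) s1 s2 1 row_insert_word_Cons_le[of "[x, z, y]" h t]
        row_insert_word_Cons_le[of "[z, x, y]" h t] by simp_all
    then show ?thesis
      using Cons.IH[OF ht(1) Cons.prems(2,3) s1 s2] by simp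
  next
    case 2
    then have h: "\<not> z < h" by simp
    obtain s1 b where s1: "row_insert t z = (s1, b)" by fastforce
    obtain s2 c where s2: "row_insert s1 y = (s2, c)" by fastforce
    have "row_insert_word (h # t) [x, z, y] = (x # s2, [h] @ ?word b @ ?word c)"
      "row_insert_word (h # t) [z, x, y] = (x # s2, ?word b @ [h] @ ?word c)"
      using 2(1) h ord s1 s2 by (simp_all split: option.split)
    with Cons.prems(4,5) have *: "r1 = x # s2" "r2 = x # s2"
      "out1 = [h] @ ?word b @ ?word c" "out2 = ?word b @ [h] @ ?word c"
      by simp_all
    show ?thesis
    proof (cases b)
      case (Some q)
      obtain p where p: "c = Some p" "p < q"
        using row_insert_less ht(1) \<open>y < z\<close> s1 s2 Some by metis
      have "p \<in> insert z (set t)"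
        using set_row_insert[OF s1] set_row_insert[OF s2] p by blast
      then have "h \<le> p" using 2 ht(2) by auto
      then show ?thesis
        using * Some p by (auto intro!: knuth_move_2)
    qed (use * in auto)
  next
    \<comment> \<open>Here the kind of the move changes: if the tail starts with \<open>k\<close>,
      then \<open>z < h \<le> k\<close>, and \<open>[h, k, z]\<close>, \<open>[h, z, k]\<close> are
      related by a move of the first kind.\<close>
    case 3
    then have h: "x < h" "y < h" "\<not> h < z" using ord Cons.prems(3) by auto
    show ?thesis
    proof (cases t)
      case Nil
      then have "r1 = r2 \<and> out1 = out2"
        using Cons.prems(3-5) 3 h ord by auto
      then show ?thesis by simp
    next
      case (Cons k t')
      then have k: "h \<le> k" "z < k" "y < k" using ht 3 h by auto
      have "row_insert_word (h # t) [x, z, y] = (x # y # t', [h, k, z])"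
        "row_insert_word (h # t) [z, x, y] = (x # y # t', [h, z, k])"
        using Cons Cons.prems(3) 3 h ord k by simp_all
      with Cons.prems(4,5) have "r1 = x # y # t'" "r2 = x # y # t'"
        "out1 = [h, k, z]" "out2 = [h, z, k]" by simp_all
      then show ?thesis using 3 k by (auto intro!: knuth_move_1)
    qed
  qed
qed

section \<open>Invariance of the P-symbol under Knuth equivalence\<close>

lemma sorted_rows_schensted_insert:
  "\<forall>r\<in>set T. sorted r \<Longrightarrow> \<forall>r\<in>set (schensted_insert T x). sorted r"
proof (induction T arbitrary: x)
  case (Cons r rs)
  obtain r' b where r': "row_insert r x = (r', b)" by fastforce
  with sorted_row_insert[OF _ r'] Cons show ?case by (cases b) simp_all
qed simp

lemma sorted_rows_foldl_schensted_insert: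
  "\<forall>r\<in>set T. sorted r \<Longrightarrow> \<forall>r\<in>set (foldl schensted_insert T w). sorted r"
proof (induction w arbitrary: T)
  case (Cons x w)
  show ?case
    using Cons.IH[OF sorted_rows_schensted_insert[OF Cons.prems]] by simp
qed simp

lemma foldl_schensted_insert_knuth_move:
  "\<forall>r\<in>set T. sorted r \<Longrightarrow> knuth_move w v \<Longrightarrow>
     foldl schensted_insert T w = foldl schensted_insert T v"
proof (induction T arbitrary: w v)
  case Nil
  from Nil(2) show ?case by cases auto
next
  case (Cons r rs)
  obtain r1 out1 where 1: "row_insert_word r w = (r1, out1)" by fastforce
  obtain r2 out2 where 2: "row_insert_word r v = (r2, out2)" by fastforce
  have "sorted r" using Cons.prems by simp
  from Cons.prems(2)
  have "r1 = r2 \<and> (out1 = out2 \<or> knuth_move out1 out2 \<or> knuth_move out2 out1)"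
  proof cases
    case knuth_move_1
    then show ?thesis
      using row_insert_word_knuth_move_1[OF \<open>sorted r\<close> knuth_move_1(3,4)] 1 2 by blast
  next
    case knuth_move_2
    then show ?thesis
      using row_insert_word_knuth_move_2[OF \<open>sorted r\<close> knuth_move_2(3,4)] 1 2 by blast
  qed
  moreover have "knuth_move out1 out2 \<Longrightarrow>
      foldl schensted_insert rs out1 = foldl schensted_insert rs out2"
    and "knuth_move out2 out1 \<Longrightarrow>
      foldl schensted_insert rs out2 = foldl schensted_insert rs out1"
    using Cons by auto
  ultimately show ?case
    using 1 2 by (auto simp: foldl_schensted_insert_Cons)
qed

lemma foldl_schensted_insert_knuth:
  "w \<sim> v \<Longrightarrow> \<forall>r\<in>set T. sorted r \<Longrightarrow> foldl schensted_insert T w = foldl schensted_insert T v"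
proof (induction arbitrary: T rule: knuth.induct)
  case (knuth_append w w' u v)
  then show ?case
    using sorted_rows_foldl_schensted_insert[of T u] by simp
qed (auto simp: foldl_schensted_insert_knuth_move)

lemma P_symbol_knuth: "w \<sim> v \<Longrightarrow> P_symbol w = P_symbol v"
  by (simp add: P_symbol_def foldl_schensted_insert_knuth)

text \<open>If a move loses any letter, it loses its smallest one, and then its two sides become
  equal. This serves to delete the auxiliary letters that stand for empty boxes.\<close>

lemma knuth_filter_greater: "w \<sim> v \<Longrightarrow> filter (\<lambda>s. c < s) w \<sim> filter (\<lambda>s. c < s) v"
proof (induction rule: knuth.induct)
  case (knuth_move w w')
  then show ?case
    by cases (auto intro!: knuth.knuth_move knuth_move_1 knuth_move_2)
qed (auto intro: knuth_sym knuth_trans knuth_append)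

section \<open>Row insertion of one letter as a Knuth equivalence\<close>

lemma knuth_pass_left:
  assumes "sorted (y # r)" "x < y"
  shows "(y # r) @ [x] \<sim> y # x # r"
  using assms(1)
proof (induction r rule: rev_induct)
  case (snoc z r)
  \<comment> \<open>\<open>l\<close> is the left neighbour of \<open>z\<close>, also when
    \<open>r\<close> is empty. Since \<open>x < y \<le> l \<le> z\<close>, it is the middle letter
    of the move that carries \<open>x\<close> across \<open>z\<close>.\<close>
  define l where "l = last (y # r)"
  have lr: "y # r = butlast (y # r) @ [l]" unfolding l_def by simp
  have "y \<le> l" "l \<le> z" using snoc.prems by (auto simp: l_def sorted_append)
  then have "[l, z, x] \<sim> [l, x, z]"
    using \<open>x < y\<close> by (intro knuth_move knuth_move_1) auto
  then have "butlast (y # r) @ [l, z, x] \<sim> butlast (y # r) @ [l, x, z]"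
    by (rule knuth_append_left)
  then have "(y # r @ [z]) @ [x] \<sim> ((y # r) @ [x]) @ [z]"
    using lr by (metis append.assoc append_Cons append_Nil)
  also have "\<dots> \<sim> (y # x # r) @ [z]"
    using snoc by (intro knuth_append_right) (auto simp: sorted_append)
  finally show ?case by simp
qed simp

lemma knuth_bump_left:
  assumes "sorted (r @ [x])" "x < y"
  shows "r @ [y, x] \<sim> y # r @ [x]"
  using assms
proof (induction r arbitrary: x rule: rev_induct)
  case (snoc w r)
  have "[w, y, x] \<sim> [y, w, x]"
    using snoc.prems by (intro knuth_move knuth_move_2) (auto simp: sorted_append)
  then have "r @ [w, y, x] \<sim> r @ [y, w, x]"
    by (rule knuth_append_left)
  also have "\<dots> \<sim> (y # r @ [w]) @ [x]"
    using knuth_append_right[OF snoc.IH[of w], of "[x]"] snoc.prems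
    by (auto simp: sorted_append)
  finally show ?case by simp
qed simp

text \<open>First \<open>x\<close> travels left until it stands right after \<open>y\<close>, then
  \<open>y\<close> travels to the front. The result is the bumped letter followed by the new
  row.\<close>

lemma knuth_row_insert:
  assumes "sorted (r1 @ y # r2)" "\<forall>s\<in>set r1. s \<le> x" "x < y"
  shows "r1 @ y # r2 @ [x] \<sim> y # r1 @ x # r2"
proof -
  have "r1 @ (y # r2) @ [x] \<sim> r1 @ y # x # r2"
    by (intro knuth_append_left knuth_pass_left) (use assms in \<open>auto simp: sorted_append\<close>)
  also have "r1 @ [y, x] \<sim> y # r1 @ [x]"
    by (intro knuth_bump_left) (use assms in \<open>auto simp: sorted_append\<close>)
  from knuth_append_right[OF this, of r2] have "r1 @ y # x # r2 \<sim> y # r1 @ x # r2"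
    by simp
  finally show ?thesis by simp
qed

lemma sorted_list_of_multiset_eqI:
  "sorted xs \<Longrightarrow> mset xs = A \<Longrightarrow> sorted_list_of_multiset A = xs"
  by (metis sorted_list_of_multiset_mset sorted_sort_id)

section \<open>Row insertion as a queue\<close>

text \<open>Inserting the non-decreasing word \<open>b\<close> into the row \<open>A\<close> bumps
  only letters of \<open>A\<close>, in non-decreasing order. Each letter of \<open>b\<close> opens
  one vacancy for a strictly larger letter, and smaller letters are served first; this determines
  \<open>out\<close> recursively. The inequality on sizes ensures that the subtraction in the last
  clause is not truncated.\<close>

lemma knuth_two_rows:
  assumes "sorted b"
  shows "\<exists>out. out \<subseteq># A \<and>
    sorted_list_of_multiset A @ b
      \<sim> sorted_list_of_multiset out @ sorted_list_of_multiset (A + mset b - out) \<and>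
    (\<forall>t. size {#s \<in># out. s < t#} \<le> size {#s \<in># mset b. s < t#}) \<and>
    (\<forall>t. count out t =
       min (count A t) (size {#s \<in># mset b. s < t#} - size {#s \<in># out. s < t#}))"
  using assms
proof (induction b rule: rev_induct)
  case Nil
  show ?case by (intro exI[of _ "{#}"]) simp
next
  case (snoc x b)
  let ?row = sorted_list_of_multiset
  obtain out where sub: "out \<subseteq># A"
    and eqv: "?row A @ b \<sim> ?row out @ ?row (A + mset b - out)"
    and le: "\<And>t. size {#s \<in># out. s < t#} \<le> size {#s \<in># mset b. s < t#}"
    and cnt: "\<And>t. count out t =
       min (count A t) (size {#s \<in># mset b. s < t#} - size {#s \<in># out. s < t#})"
    using snoc by (auto simp: sorted_append)
  have bx: "\<forall>s\<in>set b. s \<le> x" using snoc.prems by (auto simp: sorted_append)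
  have b_less: "{#s \<in># mset b. s < t#} = mset b" if "x < t" for t
    using bx that by (auto simp: filter_mset_eq_conv)
  \<comment> \<open>\<open>R\<close> is the row after \<open>b\<close> has been inserted; above
    \<open>x\<close> it contains only letters of \<open>A\<close>.\<close>
  define R where "R = A + mset b - out"
  have out_le: "count out t \<le> count A t" for t
    using sub by (simp add: mset_subset_eq_count)
  have count_R: "count R t = count A t - count out t" if "x < t" for t
  proof -
    have "t \<notin> set b" using that bx leD by auto
    from this[folded count_mset_0_iff] show ?thesis
      by (simp add: R_def del: count_mset_0_iff)
  qed
  have eqv': "?row A @ b @ [x] \<sim> ?row out @ ?row R @ [x]"
    using knuth_append_right[OF eqv, of "[x]"] by (simp add: R_def)
  show ?case
  proof (cases "\<exists>y \<in># R. x < y")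
    case False
    then have R0: "count R t = 0" if "x < t" for t
      using that by (auto simp: count_eq_zero_iff)
    have "?row (R + {#x#}) = ?row R @ [x]"
      using False by (intro sorted_list_of_multiset_eqI) (auto simp: sorted_append not_less)
    moreover have "A + mset (b @ [x]) - out = R + {#x#}"
      by (simp add: R_def multiset_eq_iff out_le Suc_diff_le trans_le_add1)
    ultimately have "?row A @ b @ [x] \<sim> ?row out @ ?row (A + mset (b @ [x]) - out)"
      using eqv' by simp
    moreover have "count out t =
       min (count A t) (size {#s \<in># mset (b @ [x]). s < t#} - size {#s \<in># out. s < t#})" for t
      using cnt[of t] R0[of t] count_R[of t] out_le[of t] by (cases "x < t") auto
    moreover have "size {#s \<in># out. s < t#} \<le> size {#s \<in># mset (b @ [x]). s < t#}" for t
      using le[of t] by simp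
    ultimately show ?thesis using sub by blast
  next
    case True
    \<comment> \<open>\<open>y\<close> is the letter that \<open>x\<close> bumps.\<close>
    define y where "y = Min {s \<in> set_mset R. x < s}"
    have "y \<in> {s \<in> set_mset R. x < s}"
      unfolding y_def using True by (intro Min_in) auto
    then have y: "y \<in># R" "x < y" by auto
    have y_min: "y \<le> s" if "s \<in># R" "x < s" for s
      unfolding y_def using that by (intro Min_le) auto
    have R0: "count R t = 0" if "x < t" "t < y" for t
      using that y_min[of t] by (auto simp: count_eq_zero_iff)
    have y_less: "count out y < count A y"
      using y count_R[of y] by (metis count_greater_zero_iff zero_less_diff)
    \<comment> \<open>A copy of \<open>y\<close> is left in the row, so it is the vacancies that ran
      out: the letters up to \<open>y\<close> have used all \<open>size b\<close> of them.\<close>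
    have size_y: "count out y + size {#s \<in># out. s < y#} = size b"
      using cnt[of y] le[of y] y_less b_less[OF y(2)] by auto
    \<comment> \<open>With no vacancy left, nothing beyond \<open>y\<close> has been bumped, so
      \<open>y\<close> can be appended to the sorted word of bumped letters.\<close>
    have out_y: "s \<le> y" if "s \<in># out" for s
    proof (rule ccontr)
      assume "\<not> s \<le> y"
      then have "y < s" by simp
      have "{#r \<in># out. r < y#} + replicate_mset (count out y) y \<subseteq># {#r \<in># out. r < s#}"
        using \<open>y < s\<close> by (auto simp: subseteq_mset_def)
      from size_mset_mono[OF this] have "size b \<le> size {#r \<in># out. r < s#}"
        using size_y by simp
      moreover have "{#r \<in># mset b. r < s#} = mset b"
        using \<open>y < s\<close> y(2) by (intro b_less) auto
      ultimately have "count out s = 0"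
        using cnt[of s] by simp
      then show False using that by (simp add: count_eq_zero_iff)
    qed
    define out' where "out' = out + {#y#}"
    define r1 where "r1 = ?row {#s \<in># R. s \<le> x#}"
    define r2 where "r2 = ?row ({#s \<in># R. x < s#} - {#y#})"
    have r1: "sorted r1" "\<forall>s\<in>set r1. s \<le> x"
      by (simp_all add: r1_def)
    have r2: "sorted r2" "\<forall>s\<in>set r2. y \<le> s"
      using y_min by (auto simp: r2_def dest: in_diffD)
    have "s \<le> s'" if "s \<in> set r1" "s' = y \<or> s' \<in> set r2" for s s'
    proof -
      have "s \<le> x" "y \<le> s'" using that r1 r2 by auto
      with y(2) show ?thesis by (meson less_imp_le order_trans)
    qed
    moreover have "s \<le> s'" if "s \<in> set r1" "s' = x \<or> s' \<in> set r2" for s s'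
      using that r1 calculation by blast
    moreover have "x \<le> s'" if "s' \<in> set r2" for s'
      using that r2 y(2) by (meson less_imp_le order_trans)
    ultimately have sorted: "sorted (r1 @ y # r2)" "sorted (r1 @ x # r2)"
      using r1 r2 by (simp_all add: sorted_append)
    have "R = {#s \<in># R. s \<le> x#} + {#s \<in># R. x < s#}"
      using multiset_partition[of R "\<lambda>s. s \<le> x"] by (simp add: not_le)
    then have mset_R: "mset (r1 @ y # r2) = R"
      using y by (simp add: r1_def r2_def)
    have row_R: "?row R = r1 @ y # r2"
      using sorted(1) mset_R by (rule sorted_list_of_multiset_eqI)
    have "mset (r1 @ x # r2) = R + {#x#} - {#y#}"
      using mset_R by auto
    with sorted(2) have row_R': "?row (R + {#x#} - {#y#}) = r1 @ x # r2"
      by (rule sorted_list_of_multiset_eqI)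
    have row_out: "?row out' = ?row out @ [y]"
      using out_y by (intro sorted_list_of_multiset_eqI) (auto simp: out'_def sorted_append)
    have "?row R @ [x] \<sim> y # r1 @ x # r2"
      using knuth_row_insert[OF sorted(1) r1(2) y(2)] by (simp add: row_R)
    from knuth_append_left[OF this, of "?row out"]
    have "?row out @ ?row R @ [x] \<sim> ?row out' @ ?row (R + {#x#} - {#y#})"
      by (simp only: row_R' row_out append_assoc append_Cons append_Nil)
    moreover have "A + mset (b @ [x]) - out' = R + {#x#} - {#y#}"
      by (simp add: R_def out'_def multiset_eq_iff out_le Suc_diff_le trans_le_add1)
    ultimately have "?row A @ b @ [x] \<sim> ?row out' @ ?row (A + mset (b @ [x]) - out')"
      using eqv' knuth_trans by metis
    moreover have "out' \<subseteq># A"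
      using y_less out_le by (auto simp: subseteq_mset_def out'_def)
    moreover have "size {#s \<in># out'. s < t#} \<le> size {#s \<in># mset (b @ [x]). s < t#}" for t
      using le[of t] y(2) by (auto simp: out'_def)
    moreover have "count out' t =
       min (count A t) (size {#s \<in># mset (b @ [x]). s < t#} - size {#s \<in># out'. s < t#})" for t
    proof -
      \<comment> \<open>Nothing changes up to \<open>x\<close>; between \<open>x\<close> and
        \<open>y\<close> the supply in \<open>A\<close> is exhausted; at \<open>y\<close> the new
        vacancy is used; beyond \<open>y\<close> both sizes grow by one.\<close>
      consider "t \<le> x" | "x < t" "t < y" | "t = y" | "y < t" by force
      then show ?thesis
      proof cases
        case 2
        then show ?thesis using cnt[of t] R0[of t] count_R[of t] out_le[of t]
          by (auto simp: out'_def)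
      next
        case 3
        then show ?thesis using y_less size_y b_less[OF y(2)] y(2) by (auto simp: out'_def)
      qed (use cnt[of t] y(2) in \<open>auto simp: out'_def\<close>)
    qed
    ultimately show ?thesis by blast
  qed
qed

section \<open>Blocks\<close>

lemma block_Suc: "block (Suc M) q = block M q @ replicate (q M) (enat (Suc M))"
  by (simp add: block_def)

lemma set_block: "set (block M q) \<subseteq> enat ` {1..M}"
  by (auto simp: block_def)

lemma count_block: "count (mset (block M q)) (enat (Suc j)) = (if j < M then q j else 0)"
  by (induction M) (auto simp: block_def)

lemma sorted_block: "sorted (block M q)"
proof (induction M)
  case (Suc M)
  then show ?case using set_block[of M q] by (auto simp: block_Suc sorted_append)
qed (simp add: block_def)

lemma block_eqI:
  assumes "sorted w" "set w \<subseteq> enat ` {1..M}"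
    and "\<And>j. j < M \<Longrightarrow> count (mset w) (enat (Suc j)) = q j"
  shows "w = block M q"
proof -
  have "count (mset w) s = count (mset (block M q)) s" for s
  proof (cases "s \<in> enat ` {1..M}")
    case True
    then obtain i where "i \<in> {1..M}" "s = enat i" by blast
    then obtain j where "s = enat (Suc j)" "j < M" by (cases i) auto
    then show ?thesis using assms(3) by (simp add: count_block)
  next
    case False
    then have "s \<notin> set w" "s \<notin> set (block M q)" using assms(2) set_block by blast+
    then show ?thesis by (simp flip: count_mset_0_iff)
  qed
  then show ?thesis
    using sorted_list_of_multiset_eqI[OF assms(1)] sorted_list_of_multiset_eqI[OF sorted_block]
    by (metis multiset_eqI)
qed

lemma size_filter_less_Suc:
  "size {#s \<in># B. s < enat (Suc (Suc t))#} =
     size {#s \<in># B. s < enat (Suc t)#} + count B (enat (Suc t))"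
proof -
  have "s < enat (Suc (Suc t)) \<longleftrightarrow> s < enat (Suc t) \<or> s = enat (Suc t)" for s
    by (cases s) auto
  then have "{#s \<in># B. s < enat (Suc (Suc t))#} =
      {#s \<in># B. s < enat (Suc t)#} + replicate_mset (count B (enat (Suc t))) (enat (Suc t))"
    by (auto simp: multiset_eq_iff)
  then show ?thesis by simp
qed

text \<open>The \<open>E 0\<close> boxes separating the two blocks act like \<open>E 0\<close> letters below all colors
  at the front of the second block: each of them bumps one ball out of the first block.\<close>

lemma knuth_blocks:
  assumes x: "\<And>t. t < M \<Longrightarrow> x t = min (a t) (E t)"
    and E: "\<And>t. t < M \<Longrightarrow> E (Suc t) + x t = E t + b t"
  shows "block M a @ block M b \<sim> block M x @ block M (\<lambda>t. a t - x t + b t)"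
proof -
  let ?row = sorted_list_of_multiset
  define A where "A = mset (block M a)"
  define w where "w = replicate (E 0) 0 @ block M b"
  have "sorted w"
    by (simp add: w_def sorted_append sorted_block)
  then obtain out where sub: "out \<subseteq># A"
    and eqv: "?row A @ w \<sim> ?row out @ ?row (A + mset w - out)"
    and le: "\<And>t. size {#s \<in># out. s < t#} \<le> size {#s \<in># mset w. s < t#}"
    and cnt: "\<And>t. count out t =
       min (count A t) (size {#s \<in># mset w. s < t#} - size {#s \<in># out. s < t#})"
    using knuth_two_rows[of w A] by blast
  have count_w: "count (mset w) (enat (Suc t)) = (if t < M then b t else 0)" for t
    by (simp add: w_def count_block zero_enat_def)
  have set_A: "set_mset A \<subseteq> enat ` {1..M}"
    using set_block by (simp add: A_def)
  with sub have set_out: "set_mset out \<subseteq> enat ` {1..M}"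
    by (meson order_trans set_mset_mono)
  have count_out: "count out (enat (Suc t)) = x t" if "t < M"
    "size {#s \<in># mset w. s < enat (Suc t)#} = size {#s \<in># out. s < enat (Suc t)#} + E t" for t
    using that cnt[of "enat (Suc t)"] x[of t] by (simp add: A_def count_block)
  \<comment> \<open>\<open>E t\<close> counts the vacancies still open when color
    \<open>t + 1\<close> is served. Below color 1 there are only the \<open>E 0\<close> auxiliary
    zeros.\<close>
  have queue: "size {#s \<in># mset w. s < enat (Suc t)#} =
      size {#s \<in># out. s < enat (Suc t)#} + E t" if "t \<le> M" for t
    using that
  proof (induction t)
    case 0
    have "{#s \<in># mset (block M b). s < enat (Suc 0)#} = {#}" "{#s \<in># out. s < enat (Suc 0)#} = {#}"
      using set_block[of M b] set_out by fastforce+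
    moreover have "{#s \<in># replicate_mset (E 0) 0. s < enat (Suc 0)#} = replicate_mset (E 0) 0"
      by (auto simp: filter_mset_eq_conv zero_enat_def)
    ultimately show ?case by (simp add: w_def del: filter_mset_eq_mempty_iff)
  next
    case (Suc t)
    then show ?case
      using count_out[of t] E[of t] by (simp add: size_filter_less_Suc count_w)
  qed
  have out: "?row out = block M x"
    using set_out count_out queue by (intro block_eqI) auto
  have set_R: "s \<in> enat ` {1..M}" if "s \<in># A + mset w - out" "0 < s" for s
    using in_diffD[OF that(1)] that(2) set_A set_block[of M b]
    by (auto simp: w_def split: if_splits)
  \<comment> \<open>As \<open>out\<close> is contained in \<open>A\<close>, the zeros all end up in
    the new row, from which the filter removes them.\<close>
  have R: "filter (\<lambda>s. 0 < s) (?row (A + mset w - out)) = block M (\<lambda>t. a t - x t + b t)"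
  proof (rule block_eqI)
    show "sorted (filter (\<lambda>s. 0 < s) (?row (A + mset w - out)))"
      by (rule sorted_wrt_filter) simp
    show "set (filter (\<lambda>s. 0 < s) (?row (A + mset w - out))) \<subseteq> enat ` {1..M}"
      using set_R by auto
    fix t assume "t < M"
    then show "count (mset (filter (\<lambda>s. 0 < s) (?row (A + mset w - out)))) (enat (Suc t)) =
        a t - x t + b t"
      using count_out[of t] queue[of t] x[of t]
      by (simp add: mset_filter A_def count_block count_w zero_enat_def)
  qed
  have filter_block: "filter (\<lambda>s. 0 < s) (block M q) = block M q" for q
    using set_block[of M q] by (auto intro!: filter_True simp: zero_enat_def)
  have "?row A = block M a"
    unfolding A_def by (rule sorted_list_of_multiset_eqI[OF sorted_block refl])
  moreover have "filter (\<lambda>s. 0 < s) w = block M b"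
    using filter_block[of b] by (simp add: w_def)
  ultimately show ?thesis
    using knuth_filter_greater[OF eqv, of 0] by (simp only: filter_append filter_block R out)
qed

section \<open>The time evolution as a sequence of queues\<close>

text \<open>For \<open>eps i = 1\<close> the balls of block \<open>i\<close> enter the queue at the gap \<open>i\<close> before the load coming
  from the gap \<open>i - 1\<close> arrives, for \<open>eps i = 0\<close> after it has been added.\<close>

definition active :: "nat \<Rightarrow> (nat \<Rightarrow> nat) \<Rightarrow> (nat \<Rightarrow> nat) \<Rightarrow> (nat \<Rightarrow> nat) \<Rightarrow> nat \<Rightarrow> nat" where
  "active N eps Q E i = (if eps i = 0 then step_D N eps Q E i else Q i)"

text \<open>\<open>step_D\<close> changes its role with \<open>eps i\<close>: for
  \<open>eps i = 0\<close> it counts the balls entering the queue at gap \<open>i\<close>, otherwise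
  those left behind there. \<open>stay\<close> always denotes the latter.\<close>

definition stay :: "nat \<Rightarrow> (nat \<Rightarrow> nat) \<Rightarrow> (nat \<Rightarrow> nat) \<Rightarrow> (nat \<Rightarrow> nat) \<Rightarrow> nat \<Rightarrow> nat" where
  "stay N eps Q E i = (if eps i = 0 then step_Q N eps Q E i else step_D N eps Q E i)"

definition load :: "nat \<Rightarrow> (nat \<Rightarrow> nat) \<Rightarrow> (nat \<Rightarrow> nat) \<Rightarrow> (nat \<Rightarrow> nat) \<Rightarrow> nat \<Rightarrow> nat" where
  "load N eps Q E i =
     (case i of 0 \<Rightarrow> 0 | Suc k \<Rightarrow> active N eps Q E k - stay N eps Q E k)"

text \<open>This is block \<open>i\<close> as the exchange at gap \<open>i - 1\<close> meets it:
  untouched if \<open>eps i = 0\<close>, otherwise already reduced by the exchange at gap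
  \<open>i\<close>. By \<open>early_eq\<close> it is the first minimum in the recursion for
  \<open>E\<close>.\<close>

definition early :: "nat \<Rightarrow> (nat \<Rightarrow> nat) \<Rightarrow> (nat \<Rightarrow> nat) \<Rightarrow> (nat \<Rightarrow> nat) \<Rightarrow> nat \<Rightarrow> nat" where
  "early N eps Q E i = (if eps i = 0 then Q i else stay N eps Q E i)"

lemma min_ext_simps [simp]: "min_ext x \<infinity> = x" "min_ext x (enat y) = min x y"
  by (simp_all add: min_ext_def)

lemma min_ext_le: "min_ext x a \<le> x"
  by (cases a) auto

lemma stay_eq: "stay N eps Q E i = min_ext (active N eps Q E i) (ext_E N E i)"
  by (cases i) (simp_all add: stay_def active_def)

lemma stay_le_active: "stay N eps Q E i \<le> active N eps Q E i"
  by (simp add: stay_eq min_ext_le)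

lemma active_eq: "eps i = 0 \<Longrightarrow> active N eps Q E i = Q i + load N eps Q E i"
  using stay_le_active[of N eps Q E "i - 1"]
  by (cases i) (auto simp: active_def load_def stay_def)

lemma step_Q_eq: "eps i \<noteq> 0 \<Longrightarrow> step_Q N eps Q E i = stay N eps Q E i + load N eps Q E i"
  using stay_le_active[of N eps Q E "i - 1"]
  by (cases i) (auto simp: active_def load_def stay_def)

lemma early_eq: "min_ext (Q i) (cal_E (eps i) + ext_E N E i) = early N eps Q E i"
  by (auto simp: early_def cal_E_def stay_eq active_def)

text \<open>The second minimum in the recursion for \<open>E\<close> turns out to be
  \<open>stay\<close>. The recursion thereby becomes the bookkeeping of a queue: balls left behind
  use up vacancies, balls of the next block create them.\<close>

lemma step_E_eq:
  "i + 1 < N \<Longrightarrow> step_E N eps Q E i + stay N eps Q E i = E i + early N eps Q E (i + 1)"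
proof (induction i)
  case 0
  have "step_Q N eps Q E 0 = stay N eps Q E 0"
    by (simp add: stay_def)
  moreover have "stay N eps Q E 0 \<le> E 0"
    using 0 by (simp add: stay_eq ext_E_def)
  ultimately show ?case
    using early_eq[of Q 1 eps N E] by simp
next
  case (Suc i)
  have "min_ext (step_Q N eps Q E (Suc i)) (cal_E (eps (Suc i)) + enat (step_E N eps Q E i)) =
      stay N eps Q E (Suc i)"
  proof (cases "eps (Suc i) = 0")
    case True
    then show ?thesis by (simp add: cal_E_def stay_def)
  next
    case False
    have "stay N eps Q E i = min (active N eps Q E i) (E i)"
      using Suc.prems by (simp add: stay_eq ext_E_def)
    moreover have "step_E N eps Q E i + stay N eps Q E i = E i + stay N eps Q E (Suc i)"
      using Suc False by (simp add: early_def)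
    moreover have "step_Q N eps Q E (Suc i) =
        stay N eps Q E (Suc i) + (active N eps Q E i - stay N eps Q E i)"
      using step_Q_eq[of eps "Suc i", OF False] by (simp add: load_def del: step_Q.simps)
    \<comment> \<open>Both arguments exceed \<open>stay\<close> at \<open>Suc i\<close>, one by
      \<open>active - stay\<close>, the other by \<open>E i - stay\<close>, taken at
      \<open>i\<close>. One of these excesses is zero because \<open>stay\<close> at
      \<open>i\<close> is the minimum of \<open>active\<close> and \<open>E i\<close>.\<close>
    ultimately have "min (step_Q N eps Q E (Suc i)) (step_E N eps Q E i) = stay N eps Q E (Suc i)"
      by linarith
    with False show ?thesis
      by (simp add: cal_E_def del: step_Q.simps)
  qed
  moreover have "stay N eps Q E (Suc i) \<le> E (Suc i)"
    using Suc.prems by (simp add: stay_eq ext_E_def)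
  ultimately show ?case
    using early_eq[of Q "i + 2" eps N E] by simp
qed

text \<open>The exchanges across the gaps are carried out in an order in which the gap \<open>i\<close> comes after the
  gap \<open>i - 1\<close> if \<open>eps i = 0\<close> and before it if \<open>eps i = 1\<close>.\<close>

lemma knuth_evol_prefix:
  fixes N M eps Q E
  defines "F \<equiv> evol_E N eps Q E"
  assumes "n < N"
  shows "concat (map (\<lambda>i. block M (Q i)) [0..<n]) @
      block M (\<lambda>t. early N eps (\<lambda>i. Q i t) (F t) n)
    \<sim> concat (map (\<lambda>i. block M (evol_Q N eps Q E i)) [0..<n]) @
      block M (\<lambda>t. early N eps (\<lambda>i. Q i t) (F t) n + load N eps (\<lambda>i. Q i t) (F t) n)"
  using assms(2)
proof (induction n)
  case 0
  then show ?case by (simp add: load_def)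
next
  case (Suc n)
  let ?early = "\<lambda>i t. early N eps (\<lambda>i. Q i t) (F t) i"
  let ?load = "\<lambda>i t. load N eps (\<lambda>i. Q i t) (F t) i"
  let ?stay = "\<lambda>i t. stay N eps (\<lambda>i. Q i t) (F t) i"
  let ?active = "\<lambda>i t. active N eps (\<lambda>i. Q i t) (F t) i"
  let ?old = "concat (map (\<lambda>i. block M (Q i)) [0..<n])"
  let ?new = "concat (map (\<lambda>i. block M (evol_Q N eps Q E i)) [0..<n])"
  have IH: "?old @ block M (?early n) \<sim> ?new @ block M (\<lambda>t. ?early n t + ?load n t)"
    using Suc by simp
  \<comment> \<open>The evolution runs through all gaps for one color at a time; here all colors are
    exchanged at the single gap \<open>n\<close>, with \<open>F t n\<close> vacancies for color
    \<open>t + 1\<close>.\<close>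
  have "block M (?active n) @ block M (?early (Suc n)) \<sim>
      block M (?stay n) @ block M (\<lambda>t. ?active n t - ?stay n t + ?early (Suc n) t)"
  proof (rule knuth_blocks)
    show "?stay n t = min (?active n t) (F t n)" for t
      using Suc.prems by (simp add: stay_eq ext_E_def)
    show "F (Suc t) n + ?stay n t = F t n + ?early (Suc n) t" for t
      using step_E_eq[of n N eps "\<lambda>i. Q i t" "F t"] Suc.prems by (simp add: F_def)
  qed
  then have exch: "block M (?active n) @ block M (?early (Suc n)) \<sim>
      block M (?stay n) @ block M (\<lambda>t. ?early (Suc n) t + ?load (Suc n) t)"
    by (simp add: load_def add.commute)
  show ?case
  proof (cases "eps n = 0")
    \<comment> \<open>The earlier gaps come first: they complete block \<open>n\<close> to
      \<open>?active n\<close>, which is then exchanged.\<close>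
    case True
    have eqs: "Q n = ?early n" "(\<lambda>t. ?early n t + ?load n t) = ?active n"
      "evol_Q N eps Q E n = ?stay n"
      using True by (auto simp: early_def active_eq evol_Q_def stay_def F_def)
    have "?old @ block M (Q n) @ block M (?early (Suc n)) \<sim>
        ?new @ block M (?active n) @ block M (?early (Suc n))"
      using knuth_append_right[OF IH, of "block M (?early (Suc n))"] by (simp add: eqs)
    from knuth_trans[OF this knuth_append_left[OF exch]] show ?thesis
      by (simp add: eqs)
  next
    case False
    \<comment> \<open>The exchange at gap \<open>n\<close> comes first and leaves
      \<open>?stay n\<close>, the form of block \<open>n\<close> to which the induction hypothesis
      applies.\<close>
    let ?rest = "block M (\<lambda>t. ?early (Suc n) t + ?load (Suc n) t)"
    have eqs: "Q n = ?active n" "\<And>t. ?early n t = ?stay n t"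
      "evol_Q N eps Q E n = (\<lambda>t. ?stay n t + ?load n t)"
      using False by (auto simp: early_def active_def evol_Q_def step_Q_eq F_def)
    have "?old @ block M (?stay n) @ ?rest \<sim> ?new @ block M (evol_Q N eps Q E n) @ ?rest"
      using knuth_append_right[OF IH, of ?rest] by (simp add: eqs)
    from knuth_trans[OF knuth_append_left[OF exch] this] show ?thesis
      by (simp add: eqs(1))
  qed
qed

text \<open>Beyond the last block there are infinitely many vacancies, so all its active balls stay.
  The partial last block in \<open>knuth_evol_prefix\<close> is then the full one, both before and
  after.\<close>

lemma knuth_evol:
  "concat (map (\<lambda>i. block M (Q i)) [0..<N]) \<sim>
     concat (map (\<lambda>i. block M (evol_Q N eps Q E i)) [0..<N])"
proof (cases N)
  case (Suc n)
  let ?F = "evol_E N eps Q E"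
  have stay: "stay N eps (\<lambda>i. Q i t) (?F t) n = active N eps (\<lambda>i. Q i t) (?F t) n" for t
    using Suc by (simp add: stay_eq ext_E_def)
  have "(\<lambda>t. early N eps (\<lambda>i. Q i t) (?F t) n) = Q n"
    using stay by (auto simp: early_def active_def)
  moreover have "(\<lambda>t. early N eps (\<lambda>i. Q i t) (?F t) n + load N eps (\<lambda>i. Q i t) (?F t) n) =
      evol_Q N eps Q E n"
    using stay active_eq[of eps n N] step_Q_eq[of eps n N]
    by (cases "eps n = 0") (auto simp: early_def evol_Q_def stay_def)
  ultimately show ?thesis
    using knuth_evol_prefix[of n N M Q eps E] Suc by simp
qed simp

section \<open>Ball words in coordinates\<close>

lemma ball_word_nth:
  "ball_word (\<lambda>p. if p < length w then w ! p else empty_box) = filter (\<lambda>s. s \<noteq> empty_box) w"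
proof -
  have "sorted_list_of_set {p. (if p < length w then w ! p else empty_box) \<noteq> empty_box} =
      filter (\<lambda>p. w ! p \<noteq> empty_box) [0..<length w]"
    by (rule sorted_distinct_set_unique) (auto simp: sorted_wrt_filter split: if_splits)
  then have "ball_word (\<lambda>p. if p < length w then w ! p else empty_box) =
      map (\<lambda>p. if p < length w then w ! p else empty_box)
        (filter (\<lambda>p. w ! p \<noteq> empty_box) [0..<length w])"
    by (simp add: ball_word_def)
  also have "\<dots> = map ((!) w) (filter (\<lambda>p. w ! p \<noteq> empty_box) [0..<length w])"
    by (intro map_cong) auto
  also have "\<dots> = filter (\<lambda>s. s \<noteq> empty_box) (map ((!) w) [0..<length w])"
    by (simp add: filter_map o_def)
  finally show ?thesis by (simp only: map_nth)
qed

lemma ball_word_Phi: "ball_word (Phi M N Q L E) = concat (map (\<lambda>i. block M (Q i)) [0..<N])"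
proof -
  have "filter (\<lambda>s. s \<noteq> empty_box) (block M q) = block M q" for q
    using set_block[of M q] by (auto intro!: filter_True)
  then show ?thesis
    unfolding Phi_def Let_def ball_word_nth
    by (simp add: filter_concat o_def if_distrib cong: if_cong)
qed

section \<open>Cutting a state into its runs\<close>

lemma sorted_list_of_set_concat:
  fixes r :: "nat \<Rightarrow> nat"
  assumes "finite B" "mono r"
  shows "sorted_list_of_set {p \<in> B. r p < n} =
    concat (map (\<lambda>k. sorted_list_of_set {p \<in> B. r p = k}) [0..<n])"
proof (induction n)
  case (Suc n)
  have less: "p < q" if "r p < r q" for p q
    using that \<open>mono r\<close> by (meson leD leI monoD)
  have "sorted_list_of_set {p \<in> B. r p < Suc n} =
      sorted_list_of_set {p \<in> B. r p < n} @ sorted_list_of_set {p \<in> B. r p = n}"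
    using \<open>finite B\<close> less
    by (intro sorted_distinct_set_unique) (auto simp: sorted_append less_imp_le)
  with Suc show ?case by simp
qed simp

lemma ball_word_coord:
  assumes "u \<in> Omega_N M N"
  shows "ball_word u = concat (map (\<lambda>i. block M (coord_Q u i)) [0..<N])"
proof -
  define B where "B = {p. u p \<noteq> empty_box}"
  \<comment> \<open>\<open>r p\<close> is the index of the run containing \<open>p\<close>, and
    \<open>m\<close> is the shift caused by an initial run of empty boxes. With \<open>m\<close> the
    two cases in \<open>Omega_N\<close> become the single equation \<open>N\<close> below.\<close>
  define r where "r p = card {i. i < p \<and> u i > u (Suc i)}" for p
  define m :: nat where "m = (if u 0 = empty_box then 1 else 0)"
  have "u \<in> Omega M" and N: "des u + 1 = N + m"
    using assms by (auto simp: Omega_N_def m_def)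
  then have fin: "finite B" and u: "\<forall>p. u p \<in> enat ` {1..M} \<union> {empty_box}"
    by (simp_all add: Omega_def B_def)
  have letters: "u p \<in> enat ` {1..M}" if "p \<in> B" for p
    using u[rule_format, of p] that unfolding B_def by blast
  have r_Suc: "r (Suc p) = r p + (if u p > u (Suc p) then 1 else 0)" for p
  proof -
    have "{i. i < Suc p \<and> u i > u (Suc i)} =
        {i. i < p \<and> u i > u (Suc i)} \<union> (if u p > u (Suc p) then {p} else {})"
      by (auto simp: less_Suc_eq)
    then show ?thesis by (simp add: r_def)
  qed
  then have "mono r" by (simp add: mono_iff_le_Suc)
  have sorted_run: "u p \<le> u q" if "p \<le> q" "r p = r q" for p q
    using that
  proof (induction rule: dec_induct)
    case (step q)
    have "r p \<le> r q" "r q \<le> r (Suc q)"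
      using \<open>mono r\<close> step.hyps by (auto intro: monoD)
    with step r_Suc[of q] show ?case
      by (auto split: if_splits)
  qed simp
  \<comment> \<open>A ball cannot lie in the initial run if that run starts with the largest letter.
    Hence \<open>r p - m\<close> is a genuine difference on \<open>B\<close>.\<close>
  have m_le: "m \<le> r p" if "p \<in> B" for p
  proof (rule ccontr)
    assume "\<not> m \<le> r p"
    then have "u 0 = empty_box" "r p = r 0"
      by (auto simp: m_def r_def[of 0] split: if_splits)
    with sorted_run[of 0 p] that show False by (simp add: B_def)
  qed
  have le_des: "r p \<le> des u" for p
  proof -
    \<comment> \<open>Every descent ends at a ball, so there are only finitely many
      descents.\<close>
    have "{i. u i > u (Suc i)} \<subseteq> Suc -` B"
      by (auto simp: B_def dest: less_le_trans[OF _ enat_ord_code(3)[THEN eqTrueE]])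
    then have "finite {i. u i > u (Suc i)}"
      using finite_vimageI[OF fin] by (rule finite_subset) simp
    then show ?thesis
      unfolding r_def des_def by (intro card_mono) auto
  qed
  have "r p - m < N" if "p \<in> B" for p
    using m_le[OF that] le_des[of p] N by linarith
  then have "{p \<in> B. r p - m < N} = B" by blast
  moreover have "mono (\<lambda>p. r p - m)"
    using \<open>mono r\<close> by (auto simp: mono_def diff_le_mono)
  ultimately have "sorted_list_of_set B =
      concat (map (\<lambda>k. sorted_list_of_set {p \<in> B. r p - m = k}) [0..<N])"
    using sorted_list_of_set_concat[OF fin, of "\<lambda>p. r p - m" N] by simp
  then have "ball_word u =
      concat (map (\<lambda>k. map u (sorted_list_of_set {p \<in> B. r p - m = k})) [0..<N])"
    by (simp add: ball_word_def B_def map_concat o_def)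
  moreover have "map u (sorted_list_of_set {p \<in> B. r p - m = k}) = block M (coord_Q u k)" for k
  proof (rule block_eqI)
    let ?S = "{p \<in> B. r p - m = k}"
    have "finite ?S" using fin by simp
    have "sorted_wrt (\<lambda>p q. u p \<le> u q) (sorted_list_of_set ?S)"
    proof (rule sorted_wrt_mono_rel[OF _ sorted_sorted_list_of_set])
      fix p q assume "p \<in> set (sorted_list_of_set ?S)" "q \<in> set (sorted_list_of_set ?S)" "p \<le> q"
      then show "u p \<le> u q"
        using \<open>finite ?S\<close> m_le[of p] m_le[of q] by (intro sorted_run) auto
    qed
    then show "sorted (map u (sorted_list_of_set ?S))"
      by (simp add: sorted_map)
    show "set (map u (sorted_list_of_set ?S)) \<subseteq> enat ` {1..M}"
      using \<open>finite ?S\<close> letters by auto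
    fix j
    have "count (mset (map u ps)) c = length (filter (\<lambda>p. u p = c) ps)" for ps c
      by (induction ps) auto
    then have "count (mset (map u (sorted_list_of_set ?S))) (enat (Suc j)) =
        length (filter (\<lambda>p. u p = enat (Suc j)) (sorted_list_of_set ?S))" .
    also have "\<dots> = card {p \<in> ?S. u p = enat (Suc j)}"
      using \<open>finite ?S\<close> distinct_card[of "filter (\<lambda>p. u p = enat (Suc j)) (sorted_list_of_set ?S)"]
      by simp
    also have "{p \<in> ?S. u p = enat (Suc j)} = {p \<in> block_run u k. u p = enat (j + 1)}"
    proof -
      have "block_run u k = {p. r p = k + m}"
        by (auto simp: block_run_def run_def r_def m_def)
      moreover have "p \<in> B" if "u p = enat (Suc j)" for p
        using that by (simp add: B_def)
      moreover have "r p - m = k \<longleftrightarrow> r p = k + m" if "p \<in> B" for p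
        using m_le[OF that] by auto
      ultimately show ?thesis by auto
    qed
    finally show "count (mset (map u (sorted_list_of_set ?S))) (enat (Suc j)) = coord_Q u k j"
      by (simp add: coord_Q_def)
  qed
  ultimately show ?thesis by simp
qed

theorem proposition4p1:
  fixes M N :: nat and eps :: "nat \<Rightarrow> nat" and u :: state
  assumes "M \<ge> 1"
    and "\<And>i. i < N \<Longrightarrow> eps i \<in> {0, 1}"
    and "u \<in> Omega_N M N"
  shows "P_symbol (ball_word u) = P_symbol (ball_word (time_evolution M N eps u))"
proof (cases "N = 0")
  case False
  then have "ball_word (time_evolution M N eps u) =
      concat (map (\<lambda>i. block M (evol_Q N eps (coord_Q u) (coord_E u) i)) [0..<N])"
    by (simp add: time_evolution_def ball_word_Phi)
  then show ?thesis
    using P_symbol_knuth[OF knuth_evol] ball_word_coord[OF assms(3)] by simp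
qed (simp add: time_evolution_def)

end
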